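(* Let $S$ be an AG-groupoid with left identity. Then the following statements are equivalent: (i) $S$ is intra-regular; (ii) every intuitionistic fuzzy right (respectively left, respectively two-sided) ideal of $S$ is intuitionistic fuzzy semiprime. That is, each of the three versions of (ii) (for right ideals, for left ideals, for two-sided ideals) is equivalent to (i).
   Context: An AG-groupoid is a non-empty set $S$ with a binary operation satisfying the left invertive law $(ab)c=(cb)a$ for all $a,b,c\in S$ (no associativity is assumed); $a^2$ denotes $aa$. A left identity is an element $e\in S$ with $ea=a$ for all $a\in S$. $S$ is intra-regular if for every $a\in S$ there are $x,y\in S$ with $a=(xa^2)y$. An intuitionistic fuzzy set (IFS) of $S$ is a pair $A=(\mu_A,\gamma_A)$ of functions $\mu_A,\gamma_A:S\to[0,1]$ with $0\le \mu_A(x)+\gamma_A(x)\le 1$ for all $x\in S$. An IFS $A$ is an intuitionistic fuzzy left ideal if $\mu_A(xy)\ge\mu_A(y)$ and $\gamma_A(xy)\le\gamma_A(y)$ for all $x,y\in S$; an intuitionistic fuzzy right ideal if $\mu_A(xy)\ge\mu_A(x)$ and $\gamma_A(xy)\le\gamma_A(x)$ for all $x,y\in S$; an intuitionistic fuzzy two-sided ideal if it is both. An IFS $A$ is intuitionistic fuzzy semiprime if $\mu_A(a)\ge\mu_A(a^2)$ and $\gamma_A(a)\le\gamma_A(a^2)$ for all $a\in S$. *)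

theory Defs
  imports Complex_Main "HOL-Library.FuncSet"
begin

locale ag_groupoid =
  fixes S :: "'a set"
    and mult :: "'a \<Rightarrow> 'a \<Rightarrow> 'a"  (infixl "\<cdot>" 70)
  assumes nonempty: "S \<noteq> {}"
    and closed: "a \<in> S \<Longrightarrow> b \<in> S \<Longrightarrow> a \<cdot> b \<in> S"
    and left_invertive: "a \<in> S \<Longrightarrow> b \<in> S \<Longrightarrow> c \<in> S \<Longrightarrow> (a \<cdot> b) \<cdot> c = (c \<cdot> b) \<cdot> a"

definition left_identity :: "'a set \<Rightarrow> ('a \<Rightarrow> 'a \<Rightarrow> 'a) \<Rightarrow> 'a \<Rightarrow> bool" where
  "left_identity S mult e \<longleftrightarrow> e \<in> S \<and> (\<forall>a\<in>S. mult e a = a)"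

definition intra_regular :: "'a set \<Rightarrow> ('a \<Rightarrow> 'a \<Rightarrow> 'a) \<Rightarrow> bool" where
  "intra_regular S mult \<longleftrightarrow> (\<forall>a\<in>S. \<exists>x\<in>S. \<exists>y\<in>S. a = mult (mult x (mult a a)) y)"

text \<open>
  An intuitionistic fuzzy set is a pair of a membership and a non-membership function.
  Both are total functions on the ambient type; only their values on \<open>S\<close> are constrained,
  and no notion below looks at values outside \<open>S\<close>.
\<close>

type_synonym 'a fuzzy_pair = "('a \<Rightarrow> real) \<times> ('a \<Rightarrow> real)"

definition if_set :: "'a set \<Rightarrow> 'a fuzzy_pair \<Rightarrow> bool" where
  "if_set S = (\<lambda>(\<mu>, \<gamma>).
     \<mu> \<in> S \<rightarrow> {0..1} \<and> \<gamma> \<in> S \<rightarrow> {0..1} \<and> (\<forall>x\<in>S. 0 \<le> \<mu> x + \<gamma> x \<and> \<mu> x + \<gamma> x \<le> 1))"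

definition if_left_ideal :: "'a set \<Rightarrow> ('a \<Rightarrow> 'a \<Rightarrow> 'a) \<Rightarrow> 'a fuzzy_pair \<Rightarrow> bool" where
  "if_left_ideal S mult A \<longleftrightarrow> if_set S A \<and>
     (case A of (\<mu>, \<gamma>) \<Rightarrow> \<forall>x\<in>S. \<forall>y\<in>S. \<mu> (mult x y) \<ge> \<mu> y \<and> \<gamma> (mult x y) \<le> \<gamma> y)"

definition if_right_ideal :: "'a set \<Rightarrow> ('a \<Rightarrow> 'a \<Rightarrow> 'a) \<Rightarrow> 'a fuzzy_pair \<Rightarrow> bool" where
  "if_right_ideal S mult A \<longleftrightarrow> if_set S A \<and>
     (case A of (\<mu>, \<gamma>) \<Rightarrow> \<forall>x\<in>S. \<forall>y\<in>S. \<mu> (mult x y) \<ge> \<mu> x \<and> \<gamma> (mult x y) \<le> \<gamma> x)"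

definition if_two_sided_ideal :: "'a set \<Rightarrow> ('a \<Rightarrow> 'a \<Rightarrow> 'a) \<Rightarrow> 'a fuzzy_pair \<Rightarrow> bool" where
  "if_two_sided_ideal S mult A \<longleftrightarrow> if_left_ideal S mult A \<and> if_right_ideal S mult A"

definition if_semiprime :: "'a set \<Rightarrow> ('a \<Rightarrow> 'a \<Rightarrow> 'a) \<Rightarrow> 'a fuzzy_pair \<Rightarrow> bool" where
  "if_semiprime S mult A \<longleftrightarrow> if_set S A \<and>
     (case A of (\<mu>, \<gamma>) \<Rightarrow> \<forall>a\<in>S. \<mu> a \<ge> \<mu> (mult a a) \<and> \<gamma> a \<le> \<gamma> (mult a a))"

end

theory Submission
  imports Defs "HOL-Library.Indicator_Function"
begin

text \<open>
  With a left identity, right ideals are left ideals, and the sets \<open>S a\<^sup>2\<close>, \<open>a\<^sup>2 S\<close> and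
  \<open>(S a\<^sup>2) S\<close> coincide. Intra-regularity thus says \<open>a \<in> S a\<^sup>2\<close> for every \<open>a\<close>, which makes every
  left ideal semiprime. Conversely, \<open>S a\<^sup>2\<close> is a two-sided ideal containing \<open>a\<^sup>2\<close>, and
  semiprimality of its characteristic function puts \<open>a\<close> into it.
\<close>

text \<open>The second component is the complementary indicator, so the two values always sum to 1
  and any set yields an intuitionistic fuzzy set.\<close>

definition char_pair :: "'a set \<Rightarrow> 'a fuzzy_pair" where
  "char_pair J = (indicat_real J, indicat_real (- J))"

lemma if_set_char_pair: "if_set S (char_pair J)"
  by (auto simp: if_set_def char_pair_def indicator_def)

lemma if_two_sided_ideal_char_pair:
  assumes "\<And>s j. s \<in> S \<Longrightarrow> j \<in> J \<Longrightarrow> mult s j \<in> J"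
    and "\<And>s j. s \<in> S \<Longrightarrow> j \<in> J \<Longrightarrow> mult j s \<in> J"
  shows "if_two_sided_ideal S mult (char_pair J)"
  unfolding if_two_sided_ideal_def if_left_ideal_def if_right_ideal_def
  using assms if_set_char_pair[of S J] by (auto simp: char_pair_def indicator_def)

text \<open>Membership degree 1 at the square forces degree at least 1 at \<open>a\<close>, and an
  indicator takes only the values 0 and 1.\<close>

lemma if_semiprime_char_pairD:
  assumes "if_semiprime S mult (char_pair J)" "a \<in> S" "mult a a \<in> J"
  shows "a \<in> J"
  using assms by (force simp: if_semiprime_def char_pair_def indicator_def split: if_splits)

context ag_groupoid
begin

lemma medial:
  assumes "a \<in> S" "b \<in> S" "c \<in> S" "d \<in> S"
  shows "(a \<cdot> b) \<cdot> (c \<cdot> d) = (a \<cdot> c) \<cdot> (b \<cdot> d)"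
proof -
  have "(a \<cdot> b) \<cdot> (c \<cdot> d) = ((c \<cdot> d) \<cdot> b) \<cdot> a"
    using assms by (simp add: left_invertive[of a b "c \<cdot> d"] closed)
  also have "\<dots> = ((b \<cdot> d) \<cdot> c) \<cdot> a"
    using assms by (simp add: left_invertive[of c d b])
  also have "\<dots> = (a \<cdot> c) \<cdot> (b \<cdot> d)"
    using assms by (simp add: left_invertive[of "b \<cdot> d" c a] closed)
  finally show ?thesis .
qed

end

locale ag_groupoid_left_identity = ag_groupoid +
  fixes e
  assumes left_identity: "left_identity S (\<cdot>) e"
begin

lemma e_closed: "e \<in> S" and e_left: "a \<in> S \<Longrightarrow> e \<cdot> a = a"
  using left_identity by (auto simp: left_identity_def)

text \<open>This is the medial law with \<open>e\<close> as first factor.\<close>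

lemma left_commute:
  assumes "a \<in> S" "b \<in> S" "c \<in> S"
  shows "a \<cdot> (b \<cdot> c) = b \<cdot> (a \<cdot> c)"
  using medial[of e a b c] assms by (simp add: e_closed e_left)

text \<open>Left commutation around one left invertive step gives the paramedial law \<open>(a
  \<cdot> b) \<cdot> (c \<cdot> d) = (d \<cdot> b) \<cdot> (c \<cdot> a)\<close>; the medial law
  then completes the reversal.\<close>

lemma mult_mult_reverse:
  assumes "a \<in> S" "b \<in> S" "c \<in> S" "d \<in> S"
  shows "(a \<cdot> b) \<cdot> (c \<cdot> d) = (d \<cdot> c) \<cdot> (b \<cdot> a)"
proof -
  have "(a \<cdot> b) \<cdot> (c \<cdot> d) = c \<cdot> ((a \<cdot> b) \<cdot> d)"
    using assms by (simp add: left_commute[of "a \<cdot> b"] closed)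
  also have "\<dots> = c \<cdot> ((d \<cdot> b) \<cdot> a)"
    using assms by (simp add: left_invertive[of a b d])
  also have "\<dots> = (d \<cdot> b) \<cdot> (c \<cdot> a)"
    using assms by (simp add: left_commute[of c] closed)
  also have "\<dots> = (d \<cdot> c) \<cdot> (b \<cdot> a)"
    using assms by (simp add: medial[of d b c a])
  finally show ?thesis .
qed

text \<open>Reversing a product leaves the square \<open>a \<cdot> a\<close> unchanged. Writing
  \<open>t\<close> as \<open>e \<cdot> t\<close> therefore lets the square change sides, at the cost
  of a right factor \<open>e\<close> on \<open>t\<close>.\<close>

lemma square_mult_eq:
  assumes "a \<in> S" "t \<in> S"
  shows "(a \<cdot> a) \<cdot> t = (t \<cdot> e) \<cdot> (a \<cdot> a)"
  using mult_mult_reverse[of a a e t] assms by (simp add: e_closed e_left)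

lemma mult_square_eq:
  assumes "a \<in> S" "s \<in> S"
  shows "s \<cdot> (a \<cdot> a) = (a \<cdot> a) \<cdot> (s \<cdot> e)"
  using mult_mult_reverse[of e s a a] assms by (simp add: e_closed e_left)

lemma mult_square_mult_eq:
  assumes "a \<in> S" "x \<in> S" "y \<in> S"
  shows "(x \<cdot> (a \<cdot> a)) \<cdot> y = (a \<cdot> a) \<cdot> ((y \<cdot> e) \<cdot> x)"
proof -
  have "(x \<cdot> (a \<cdot> a)) \<cdot> y = (x \<cdot> (a \<cdot> a)) \<cdot> (e \<cdot> y)"
    using assms by (simp add: e_left)
  also have "\<dots> = (y \<cdot> e) \<cdot> ((a \<cdot> a) \<cdot> x)"
    using assms by (simp add: mult_mult_reverse[of x _ e y] e_closed closed)
  also have "\<dots> = (a \<cdot> a) \<cdot> ((y \<cdot> e) \<cdot> x)"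
    using assms by (simp add: left_commute[of "y \<cdot> e"] e_closed closed)
  finally show ?thesis .
qed

lemma intra_regular_iff:
  "intra_regular S (\<cdot>) \<longleftrightarrow> (\<forall>a\<in>S. \<exists>s\<in>S. a = s \<cdot> (a \<cdot> a))"
proof -
  have "(\<exists>x\<in>S. \<exists>y\<in>S. a = (x \<cdot> (a \<cdot> a)) \<cdot> y) \<longleftrightarrow> (\<exists>s\<in>S. a = s \<cdot> (a \<cdot> a))"
    if a: "a \<in> S" for a
  proof
    assume "\<exists>x\<in>S. \<exists>y\<in>S. a = (x \<cdot> (a \<cdot> a)) \<cdot> y"
    then obtain x y where xy: "x \<in> S" "y \<in> S" "a = (x \<cdot> (a \<cdot> a)) \<cdot> y"
      by blast
    then have "a = (((y \<cdot> e) \<cdot> x) \<cdot> e) \<cdot> (a \<cdot> a)"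
      using a mult_square_mult_eq square_mult_eq by (metis closed e_closed)
    then show "\<exists>s\<in>S. a = s \<cdot> (a \<cdot> a)"
      using xy by (meson closed e_closed)
  next
    assume "\<exists>s\<in>S. a = s \<cdot> (a \<cdot> a)"
    then obtain s where s: "s \<in> S" "a = s \<cdot> (a \<cdot> a)"
      by blast
    \<comment> \<open>The witnesses are \<open>s \<cdot> e\<close> and \<open>e\<close>: pulling the
      square to the front leaves \<open>(e \<cdot> e) \<cdot> (s \<cdot> e)\<close>, which collapses
      to \<open>s \<cdot> e\<close>, and \<open>mult_square_eq\<close> leads back to
      \<open>s \<cdot> (a \<cdot> a)\<close>.\<close>
    have "((s \<cdot> e) \<cdot> (a \<cdot> a)) \<cdot> e = (a \<cdot> a) \<cdot> (s \<cdot> e)"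
      using a s(1) by (simp add: mult_square_mult_eq e_closed e_left closed)
    then have "a = ((s \<cdot> e) \<cdot> (a \<cdot> a)) \<cdot> e"
      using a s mult_square_eq by simp
    then show "\<exists>x\<in>S. \<exists>y\<in>S. a = (x \<cdot> (a \<cdot> a)) \<cdot> y"
      using s(1) by (meson closed e_closed)
  qed
  then show ?thesis
    by (simp add: intra_regular_def)
qed

text \<open>Since \<open>x \<cdot> y = (e \<cdot> x) \<cdot> y = (y \<cdot> x) \<cdot> e\<close>,
  every product can be rewritten to begin with its right factor; two uses of the right ideal
  inequality then give the left one.\<close>

lemma if_right_ideal_iff_two_sided:
  "if_right_ideal S (\<cdot>) A \<longleftrightarrow> if_two_sided_ideal S (\<cdot>) A"
proof -
  have swap: "x \<cdot> y = (y \<cdot> x) \<cdot> e" if "x \<in> S" "y \<in> S" for x y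
    using left_invertive[of e x y] that by (simp add: e_closed e_left)
  have "if_left_ideal S (\<cdot>) A" if "if_right_ideal S (\<cdot>) A"
  proof -
    obtain \<mu> \<gamma> where A: "A = (\<mu>, \<gamma>)" by fastforce
    have right: "\<mu> x \<le> \<mu> (x \<cdot> y)" "\<gamma> (x \<cdot> y) \<le> \<gamma> x" if "x \<in> S" "y \<in> S" for x y
      using \<open>if_right_ideal S (\<cdot>) A\<close> that by (auto simp: A if_right_ideal_def)
    have "\<mu> y \<le> \<mu> (x \<cdot> y)" "\<gamma> (x \<cdot> y) \<le> \<gamma> y" if "x \<in> S" "y \<in> S" for x y
      using right[of y x] right[of "y \<cdot> x" e] that
      by (auto simp: swap[of x y] e_closed closed)
    then show ?thesis
      using that by (simp add: A if_left_ideal_def if_right_ideal_def)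
  qed
  then show ?thesis
    by (auto simp: if_two_sided_ideal_def)
qed

lemma if_left_ideal_semiprime:
  assumes "intra_regular S (\<cdot>)" "if_left_ideal S (\<cdot>) A"
  shows "if_semiprime S (\<cdot>) A"
proof -
  obtain \<mu> \<gamma> where A: "A = (\<mu>, \<gamma>)" by fastforce
  have "\<mu> (a \<cdot> a) \<le> \<mu> a \<and> \<gamma> a \<le> \<gamma> (a \<cdot> a)" if a: "a \<in> S" for a
  proof -
    obtain s where "s \<in> S" "a = s \<cdot> (a \<cdot> a)"
      using assms(1) a by (auto simp: intra_regular_iff)
    moreover have "\<mu> (a \<cdot> a) \<le> \<mu> (s \<cdot> (a \<cdot> a)) \<and> \<gamma> (s \<cdot> (a \<cdot> a)) \<le> \<gamma> (a \<cdot> a)"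
      using assms(2) \<open>s \<in> S\<close> a by (simp add: A if_left_ideal_def closed)
    ultimately show ?thesis by simp
  qed
  then show ?thesis
    using assms(2) by (simp add: A if_semiprime_def if_left_ideal_def)
qed

lemma intra_regular_if_two_sided_semiprime:
  assumes semiprime: "\<And>A. if_two_sided_ideal S (\<cdot>) A \<Longrightarrow> if_semiprime S (\<cdot>) A"
  shows "intra_regular S (\<cdot>)"
  unfolding intra_regular_iff
proof
  fix a assume a: "a \<in> S"
  define J where "J = (\<lambda>s. s \<cdot> (a \<cdot> a)) ` S"
  have square_mult_J: "(a \<cdot> a) \<cdot> t \<in> J" if "t \<in> S" for t
    using square_mult_eq[OF a that] that by (auto simp: J_def closed e_closed)
  have "t \<cdot> j \<in> J" if t: "t \<in> S" and j: "j \<in> J" for t j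
  proof -
    obtain s where s: "s \<in> S" "j = s \<cdot> (a \<cdot> a)" using j by (auto simp: J_def)
    \<comment> \<open>Once the square stands on the left of \<open>j\<close>, left commutation moves
      it past \<open>t\<close>, so the product has the form treated in
      \<open>square_mult_J\<close>.\<close>
    have "t \<cdot> j = (a \<cdot> a) \<cdot> (t \<cdot> (s \<cdot> e))"
      using a t s by (simp add: mult_square_eq left_commute[of t] closed e_closed)
    then show ?thesis using square_mult_J t s(1) by (simp add: closed e_closed)
  qed
  moreover have "j \<cdot> t \<in> J" if t: "t \<in> S" and j: "j \<in> J" for t j
    using j square_mult_J a t by (auto simp: J_def mult_square_mult_eq closed e_closed)
  ultimately have "if_semiprime S (\<cdot>) (char_pair J)"
    by (intro semiprime if_two_sided_ideal_char_pair)
  moreover have "a \<cdot> a \<in> J"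
    using a e_closed e_left[of "a \<cdot> a"] by (force simp: J_def closed)
  ultimately have "a \<in> J"
    using a by (blast intro: if_semiprime_char_pairD)
  then show "\<exists>s\<in>S. a = s \<cdot> (a \<cdot> a)"
    by (auto simp: J_def)
qed

end

theorem theorem10:
  fixes S :: "'a set" and mult :: "'a \<Rightarrow> 'a \<Rightarrow> 'a"
  assumes "ag_groupoid S mult"
    and "\<exists>e. left_identity S mult e"
  shows "(intra_regular S mult \<longleftrightarrow>
            (\<forall>A. if_right_ideal S mult A \<longrightarrow> if_semiprime S mult A)) \<and>
         (intra_regular S mult \<longleftrightarrow>
            (\<forall>A. if_left_ideal S mult A \<longrightarrow> if_semiprime S mult A)) \<and>
         (intra_regular S mult \<longleftrightarrow>
            (\<forall>A. if_two_sided_ideal S mult A \<longrightarrow> if_semiprime S mult A))"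
proof -
  obtain e where "left_identity S mult e"
    using assms(2) by blast
  then interpret ag_groupoid_left_identity S mult e
    using assms(1)
    by (simp add: ag_groupoid_left_identity_def ag_groupoid_left_identity_axioms_def)
  \<comment> \<open>Intra-regularity gives the version for left ideals, which contains the one for
    two-sided ideals, which gives intra-regularity back. The version for right ideals coincides with
    the two-sided one.\<close>
  show ?thesis
    using if_left_ideal_semiprime intra_regular_if_two_sided_semiprime
    by (metis if_right_ideal_iff_two_sided if_two_sided_ideal_def)
qed

end
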